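(* There is an absolute constant $k>0$ such that for every $0<q\le 1$, every $n\in\mathbb{N}$ and every $m\in\mathbb{N}$, the $q$-Stancu operators $S_{n,q}^{\langle\alpha,\beta,\gamma\rangle}$ satisfy the following. 1. If $\alpha\ge 0$ and $\beta=\gamma=0$, then for all $x\in[0,1]$ and $f\in C[0,1]$, $$\left|\left(S_{n,q}^{\langle\alpha,0,0\rangle}\right)^m(f;x)-P(f;x)\right|\le k\,\omega_2\left(f,\sqrt{\left(\left(1-\frac{1}{[n]_q}\right)\frac{1}{1+\alpha}\right)^m x(1-x)}\right).$$ 2. If $\alpha=\beta=0$ and $\gamma>0$, then for all $x\in[0,1]$ and $f\in C[0,1]$, $$\left|\left(S_{n,q}^{\langle 0,0,\gamma\rangle}\right)^m(f;x)-f(0)\right|\le k\,\omega_2\bigl(f,\sqrt{\lambda_m(x)}\bigr)+k\,\|f\|\,\delta_m(x),$$ where $$\lambda_m(x)=\max\left\{\left(S_{n,q}^{\langle 0,0,\gamma\rangle}\right)^m(e_1;x),\ \left(S_{n,q}^{\langle 0,0,\gamma\rangle}\right)^m(e_2;x)\right\},\qquad \delta_m(x)=\left(S_{n,q}^{\langle 0,0,\gamma\rangle}\right)^m(e_1;x).$$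
   Context: $\mathbb{N}=\{1,2,\dots\}$. For $0<q<1$, $[r]_q=\frac{1-q^r}{1-q}$, and $[r]_1=r$ (for $r\ge 0$, so $[0]_q=0$); $[n]_q!=[1]_q[2]_q\cdots[n]_q$, $[0]_q!=1$; $\left[\begin{smallmatrix} n \\ k \end{smallmatrix}\right]_q=\frac{[n]_q!}{[k]_q!\,[n-k]_q!}$ for $0\le k\le n$. The $q$-Stancu operators are $$S_{n,q}^{\langle\alpha,\beta,\gamma\rangle}(f;x)=\sum_{j=0}^n f\left(\frac{[j]_q+[\beta]_q}{[n]_q+[\gamma]_q}\right)p_{n,j}(q;\alpha;x),$$ $$p_{n,j}(q;\alpha;x)=\left[\begin{matrix} n \\ j \end{matrix}\right]_q\frac{\prod_{i=0}^{j-1}(x+\alpha[i]_q)\ \prod_{s=0}^{n-j-1}(1-q^s x+\alpha[s]_q)}{\prod_{i=0}^{n-1}(1+\alpha[i]_q)},$$ for $f\in C[0,1]$, $x\in[0,1]$ (empty products equal $1$). $C[0,1]$ is the space of real-valued continuous functions on $[0,1]$ with the supremum norm $\|\cdot\|$; powers of operators denote iterated composition, and $T(f;x)$ is the value of $T(f)$ at $x$. $e_i(x)=x^i$. $P(f;x)=(1-x)f(0)+xf(1)$. The second modulus of smoothness of $f$ is $\omega_2(f,t)=\sup_{0<h\le t}\ \sup_{0\le x\le 1-2h}|f(x+2h)-2f(x+h)+f(x)|$ for $t\ge 0$, with the convention that a supremum over an empty set is $0$ (so $\omega_2(f,0)=0$). "Absolute constant" means independent of $q$, $n$, $m$, $\alpha$,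 $\gamma$, $x$ and $f$. *)

theory Defs
  imports Complex_Main
begin

definition qnum :: "real \<Rightarrow> real \<Rightarrow> real" where
  "qnum q r = (if q = 1 then r else (1 - q powr r) / (1 - q))"

definition qfact :: "real \<Rightarrow> nat \<Rightarrow> real" where
  "qfact q n = (\<Prod>i = 1..n. qnum q (real i))"

definition qbinom :: "real \<Rightarrow> nat \<Rightarrow> nat \<Rightarrow> real" where
  "qbinom q n k = qfact q n / (qfact q k * qfact q (n - k))"

definition stancu_basis :: "nat \<Rightarrow> nat \<Rightarrow> real \<Rightarrow> real \<Rightarrow> real \<Rightarrow> real" where
  "stancu_basis n j q \<alpha> x =
     qbinom q n j *
     ((\<Prod>i<j. x + \<alpha> * qnum q (real i)) *
      (\<Prod>s<n - j. 1 - q ^ s * x + \<alpha> * qnum q (real s))) /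
     (\<Prod>i<n. 1 + \<alpha> * qnum q (real i))"

text \<open>A function in \<open>C[0,1]\<close> is represented by a total function that is continuous on
  \<open>{0..1}\<close>. For \<open>0 \<le> \<beta> \<le> \<gamma>\<close> all nodes lie in \<open>{0..1}\<close>, so on \<open>{0..1}\<close> the operator and its
  iterates depend only on the values of \<open>f\<close> there.\<close>

definition q_stancu :: "nat \<Rightarrow> real \<Rightarrow> real \<Rightarrow> real \<Rightarrow> real \<Rightarrow> (real \<Rightarrow> real) \<Rightarrow> real \<Rightarrow> real" where
  "q_stancu n q \<alpha> \<beta> \<gamma> f x =
     (\<Sum>j = 0..n. f ((qnum q (real j) + qnum q \<beta>) / (qnum q (real n) + qnum q \<gamma>))
                  * stancu_basis n j q \<alpha> x)"

definition mono_fun :: "nat \<Rightarrow> real \<Rightarrow> real" where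
  "mono_fun i x = x ^ i"

definition lin_interp :: "(real \<Rightarrow> real) \<Rightarrow> real \<Rightarrow> real" where
  "lin_interp f x = (1 - x) * f 0 + x * f 1"

definition sup_norm :: "(real \<Rightarrow> real) \<Rightarrow> real" where
  "sup_norm f = (SUP x\<in>{0..1}. \<bar>f x\<bar>)"

text \<open>\<open>Sup {}\<close> is unspecified on the reals; here the supremum of the empty set is \<open>0\<close>.\<close>

definition Sup0 :: "real set \<Rightarrow> real" where
  "Sup0 A = (if A = {} then 0 else Sup A)"

definition omega2 :: "(real \<Rightarrow> real) \<Rightarrow> real \<Rightarrow> real" where
  "omega2 f t =
     Sup0 ((\<lambda>h. Sup0 ((\<lambda>x. \<bar>f (x + 2 * h) - 2 * f (x + h) + f x\<bar>) ` {0..1 - 2 * h})) ` {0<..t})"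

definition stancu_delta :: "nat \<Rightarrow> real \<Rightarrow> real \<Rightarrow> nat \<Rightarrow> real \<Rightarrow> real" where
  "stancu_delta n q \<gamma> m x = (q_stancu n q 0 0 \<gamma> ^^ m) (mono_fun 1) x"

definition stancu_lambda :: "nat \<Rightarrow> real \<Rightarrow> real \<Rightarrow> nat \<Rightarrow> real \<Rightarrow> real" where
  "stancu_lambda n q \<gamma> m x =
     max ((q_stancu n q 0 0 \<gamma> ^^ m) (mono_fun 1) x) ((q_stancu n q 0 0 \<gamma> ^^ m) (mono_fun 2) x)"

end

theory Submission imports Defs "HOL-Analysis.Analysis" begin

text \<open>
  The proof separates a statement about one function from a statement about the operators.

  The function: \<open>f - P f\<close> vanishes at \<open>0\<close> and \<open>1\<close>, and a maximum principle
  (\<open>maximum_principle_second_difference\<close>) shows that any such function whose second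
  differences of step at most \<open>t \<le> 1/2\<close> are bounded by \<open>w\<close> satisfies
  \<open>\<bar>f y - P f y\<bar> \<le> w * (1 + y * (1 - y) / t\<^sup>2)\<close> pointwise.

  The operators: an iterate \<open>T\<close> of a Stancu operator is linear, positive and fixes constants.
  Applying \<open>T\<close> to the pointwise bound at \<open>x\<close> gives
  \<open>\<bar>T f x - T (P f) x\<bar> \<le> w * (1 + T (e\<^sub>1 - e\<^sub>2) x / t\<^sup>2)\<close>, and \<open>t\<close> is then chosen near
  the square root of \<open>T (e\<^sub>1 - e\<^sub>2) x\<close>, so that the bracket is at most \<open>5\<close>; if
  that value is \<open>0\<close>, \<open>t\<close> tends to \<open>0\<close> instead
  (\<open>positive_operator_omega2\<close>).

  It remains to find \<open>T (P f)\<close> and a bound for \<open>T (e\<^sub>1 - e\<^sub>2)\<close>. For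
  \<open>\<beta> = \<gamma> = 0\<close> the operator fixes \<open>e\<^sub>0\<close> and \<open>e\<^sub>1\<close>, and \<open>e\<^sub>1 - e\<^sub>2\<close> is an eigenfunction
  with eigenvalue \<open>(1 - 1 / [n]) / (1 + \<alpha>)\<close>, so everything is explicit for the iterates. For
  \<open>\<alpha> = \<beta> = 0\<close> and \<open>\<gamma> > 0\<close>, \<open>e\<^sub>1\<close> is an eigenfunction with eigenvalue
  \<open>[n] / ([n] + [\<gamma>])\<close>. There \<open>e\<^sub>1 - e\<^sub>2 \<le> e\<^sub>1\<close> is enough, and \<open>P f - f 0\<close> is the multiple
  \<open>(f 1 - f 0) * e\<^sub>1\<close>, which is the source of the term \<open>\<parallel>f\<parallel> * \<delta>\<close>. Both eigenfunctions come
  from the moments of the Stancu basis, which follow from a Vandermonde identity with three free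
  parameters.
\<close>

section \<open>The second modulus of smoothness\<close>

lemma continuous_on_unit_bounded:
  fixes f :: "real \<Rightarrow> real"
  assumes "continuous_on {0..1} f"
  shows "\<exists>M. \<forall>x\<in>{0..1}. \<bar>f x\<bar> \<le> M"
proof -
  have "bounded (f ` {0..1})"
    using assms by (intro compact_imp_bounded compact_continuous_image) auto
  then show ?thesis
    by (simp add: bounded_iff)
qed

text \<open>
  A supremum of an unbounded set of reals is unspecified, so both facts rest on the boundedness of
  \<open>f\<close>, which makes the inner and the outer supremum of \<open>omega2\<close> genuine upper bounds.
\<close>

lemma
  assumes f: "continuous_on {0..1} f"
  shows second_difference_le_omega2:
    "\<lbrakk>0 < h; h \<le> t; 0 \<le> x; x + 2 * h \<le> 1\<rbrakk> \<Longrightarrow>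
      \<bar>f (x + 2 * h) - 2 * f (x + h) + f x\<bar> \<le> omega2 f t"
    and omega2_nonneg: "0 \<le> omega2 f t"
proof -
  obtain M where M: "\<forall>x\<in>{0..1}. \<bar>f x\<bar> \<le> M"
    using continuous_on_unit_bounded[OF f] by (elim exE)
  have "\<bar>f 0\<bar> \<le> M" using M by simp
  then have M0: "0 \<le> M" by linarith
  define D where "D h x = \<bar>f (x + 2 * h) - 2 * f (x + h) + f x\<bar>" for h x
  define V where "V h = Sup0 (D h ` {0..1 - 2 * h})" for h
  have om: "omega2 f t = Sup0 (V ` {0<..t})" for t
    unfolding omega2_def V_def D_def ..
  have D_le: "D h x \<le> 4 * M" if "0 < h" "0 \<le> x" "x + 2 * h \<le> 1" for h x
  proof -
    have "\<bar>f (x + 2 * h)\<bar> \<le> M" "\<bar>f (x + h)\<bar> \<le> M" "\<bar>f x\<bar> \<le> M"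
      using that by (simp_all add: M[rule_format])
    then show ?thesis unfolding D_def by linarith
  qed
  have D_le_V: "D h x \<le> V h" if "0 < h" "0 \<le> x" "x + 2 * h \<le> 1" for h x
  proof -
    have "bdd_above (D h ` {0..1 - 2 * h})"
      using D_le \<open>0 < h\<close> by (intro bdd_aboveI[where M = "4 * M"]) auto
    then show ?thesis
      using that unfolding V_def Sup0_def by (auto intro!: cSup_upper)
  qed
  have V_le: "V h \<le> 4 * M" if "0 < h" for h
    using that M0 D_le unfolding V_def Sup0_def by (auto intro!: cSup_least)
  have V_ge: "0 \<le> V h" if "0 < h" for h
  proof (cases "2 * h \<le> 1")
    case True
    then have "D h 0 \<le> V h" using that by (intro D_le_V) auto
    then show ?thesis unfolding D_def by linarith
  next
    case False
    then show ?thesis unfolding V_def Sup0_def by auto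
  qed
  have V_le_omega2: "V h \<le> omega2 f t" if "0 < h" "h \<le> t" for h t
  proof -
    have "bdd_above (V ` {0<..t})"
      using V_le by (intro bdd_aboveI[where M = "4 * M"]) auto
    then show ?thesis
      using that unfolding om Sup0_def by (auto intro!: cSup_upper)
  qed
  show "\<bar>f (x + 2 * h) - 2 * f (x + h) + f x\<bar> \<le> omega2 f t"
    if "0 < h" "h \<le> t" "0 \<le> x" "x + 2 * h \<le> 1"
    using D_le_V[of h x] V_le_omega2[of h t] that unfolding D_def by linarith
  show "0 \<le> omega2 f t"
  proof (cases "0 < t")
    case True
    then show ?thesis using V_ge[of t] V_le_omega2[of t t] by linarith
  next
    case False
    then show ?thesis unfolding om Sup0_def by auto
  qed
qed

section \<open>A maximum principle for second differences\<close>

text \<open>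
  Compare \<open>h\<close> with the parabola \<open>\<phi> y = w * y * (1 - y) / t\<^sup>2\<close>, whose second difference of
  step \<open>t\<close> is \<open>- 2 * w\<close>. Then \<open>h - \<phi>\<close> has a positive second difference of step \<open>t\<close>
  everywhere, so its maximum lies within distance \<open>t\<close> of an end point. There the second
  difference reaching exactly to that end point, where \<open>h\<close> vanishes, bounds the maximum by \<open>w\<close>.
\<close>

lemma maximum_principle_second_difference_pos:
  fixes h :: "real \<Rightarrow> real"
  assumes cont: "continuous_on {0..1} h" and h0: "h 0 = 0" and h1: "h 1 = 0"
    and t: "0 < t" "t \<le> 1/2" and w: "0 < w"
    and sd: "\<And>s x. \<lbrakk>0 < s; s \<le> t; 0 \<le> x; x + 2 * s \<le> 1\<rbrakk> \<Longrightarrow>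
               - w \<le> h (x + 2 * s) - 2 * h (x + s) + h x"
    and y: "y \<in> {0..1}"
  shows "h y \<le> w * (1 + y * (1 - y) / t\<^sup>2)"
proof -
  define A where "A = w / t\<^sup>2"
  have A: "0 < A" "A * t\<^sup>2 = w" using t w by (auto simp: A_def)
  define \<phi> where "\<phi> y = A * (y * (1 - y))" for y
  have \<phi>_double: "\<phi> (2 * c) \<le> 2 * \<phi> c" for c
  proof -
    have "2 * \<phi> c - \<phi> (2 * c) = 2 * (A * c\<^sup>2)"
      unfolding \<phi>_def by (simp add: algebra_simps power2_eq_square)
    moreover have "0 \<le> A * c\<^sup>2" using A by auto
    ultimately show ?thesis by linarith
  qed
  have \<phi>_refl: "\<phi> (1 - c) = \<phi> c" for c
    unfolding \<phi>_def by (simp add: algebra_simps)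
  have "continuous_on {0..1} (\<lambda>y. h y - \<phi> y)"
    unfolding \<phi>_def using cont by (intro continuous_intros)
  then obtain c where c: "c \<in> {0..1}"
    and max: "\<And>y. y \<in> {0..1} \<Longrightarrow> h y - \<phi> y \<le> h c - \<phi> c"
    using continuous_attains_sup[of "{0..1::real}" "\<lambda>y. h y - \<phi> y"] by auto
  have "h c - \<phi> c \<le> w"
  proof -
    consider "c = 0 \<or> c = 1" | "0 < c" "c < t" | "1 - t < c" "c < 1" | "t \<le> c" "c \<le> 1 - t"
      using c by force
    then show ?thesis
    proof cases
      case 1
      then show ?thesis using h0 h1 w by (auto simp: \<phi>_def)
    next
      case 2
      have "- w \<le> h (2 * c) - 2 * h c"
        using sd[of c 0] 2 t h0 by simp
      moreover have "h (2 * c) - \<phi> (2 * c) \<le> h c - \<phi> c"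
        using 2 t by (intro max) auto
      ultimately show ?thesis using \<phi>_double[of c] by linarith
    next
      case 3
      have "2 * c - 1 + 2 * (1 - c) = 1" "2 * c - 1 + (1 - c) = c" by auto
      then have "- w \<le> h 1 - 2 * h c + h (2 * c - 1)"
        using sd[of "1 - c" "2 * c - 1"] 3 t by simp
      moreover have "h (2 * c - 1) - \<phi> (2 * c - 1) \<le> h c - \<phi> c"
        using 3 t by (intro max) auto
      moreover have "\<phi> (2 * c - 1) \<le> 2 * \<phi> c"
        using \<phi>_double[of "1 - c"] \<phi>_refl[of c] \<phi>_refl[of "2 * (1 - c)"] by simp
      ultimately show ?thesis using h1 by linarith
    next
      case 4
      have "c - t + 2 * t = c + t" "c - t + t = c" by auto
      then have "- w \<le> h (c + t) - 2 * h c + h (c - t)"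
        using sd[of t "c - t"] 4 t by (simp only: diff_ge_0_iff_ge)
      moreover have "h (c + t) - \<phi> (c + t) \<le> h c - \<phi> c"
        using 4 t by (intro max) auto
      moreover have "h (c - t) - \<phi> (c - t) \<le> h c - \<phi> c"
        using 4 t by (intro max) auto
      moreover have "\<phi> (c + t) + \<phi> (c - t) = 2 * \<phi> c - 2 * (A * t\<^sup>2)"
        unfolding \<phi>_def by (simp add: algebra_simps power2_eq_square)
      ultimately show ?thesis using A w by linarith
    qed
  qed
  then have "h y \<le> w + \<phi> y" using max[OF y] by linarith
  also have "w + \<phi> y = w * (1 + y * (1 - y) / t\<^sup>2)"
    by (simp add: \<phi>_def A_def distrib_left)
  finally show ?thesis .
qed

text \<open>
  The one-sided bound applied to \<open>h\<close> and to \<open>- h\<close>. The strict positivity of \<open>w\<close>, which the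
  comparison with the parabola requires, is removed by enlarging \<open>w\<close> slightly.
\<close>

lemma maximum_principle_second_difference:
  fixes h :: "real \<Rightarrow> real"
  assumes cont: "continuous_on {0..1} h" and h0: "h 0 = 0" and h1: "h 1 = 0"
    and t: "0 < t" "t \<le> 1/2" and w: "0 \<le> w"
    and sd: "\<And>s x. \<lbrakk>0 < s; s \<le> t; 0 \<le> x; x + 2 * s \<le> 1\<rbrakk> \<Longrightarrow>
               \<bar>h (x + 2 * s) - 2 * h (x + s) + h x\<bar> \<le> w"
    and y: "y \<in> {0..1}"
  shows "\<bar>h y\<bar> \<le> w * (1 + y * (1 - y) / t\<^sup>2)"
proof -
  define K where "K = 1 + y * (1 - y) / t\<^sup>2"
  have K: "0 < K"
    using y unfolding K_def by (intro add_pos_nonneg) auto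
  have "\<bar>h y\<bar> \<le> w * K + e" if "0 < e" for e
  proof -
    define v where "v = w + e / K"
    have "0 < e / K" using that K by simp
    then have v: "0 < v" "w \<le> v" using w unfolding v_def by linarith+
    have "h y \<le> v * K"
      unfolding K_def
    proof (rule maximum_principle_second_difference_pos[OF cont h0 h1 t v(1) _ y])
      show "- v \<le> h (x + 2 * s) - 2 * h (x + s) + h x"
        if "0 < s" "s \<le> t" "0 \<le> x" "x + 2 * s \<le> 1" for s x
        using sd[OF that] v by linarith
    qed
    moreover have "- h y \<le> v * K"
      unfolding K_def
    proof (rule maximum_principle_second_difference_pos
        [where h = "\<lambda>x. - h x", OF _ _ _ t v(1) _ y])
      show "continuous_on {0..1} (\<lambda>x. - h x)" using cont by (intro continuous_intros)
      show "- v \<le> - h (x + 2 * s) - 2 * - h (x + s) + - h x"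
        if "0 < s" "s \<le> t" "0 \<le> x" "x + 2 * s \<le> 1" for s x
        using sd[OF that] v by linarith
    qed (use h0 h1 in auto)
    moreover have "v * K = w * K + e" using K by (simp add: v_def distrib_right)
    ultimately show ?thesis by linarith
  qed
  then have "\<bar>h y\<bar> \<le> w * K" by (rule field_le_epsilon)
  then show ?thesis unfolding K_def .
qed

text \<open>Subtracting the chord does not change second differences.\<close>

lemma lin_interp_error:
  fixes f :: "real \<Rightarrow> real"
  assumes cont: "continuous_on {0..1} f"
    and t: "0 < t" "t \<le> 1/2" and w: "0 \<le> w"
    and sd: "\<And>s x. \<lbrakk>0 < s; s \<le> t; 0 \<le> x; x + 2 * s \<le> 1\<rbrakk> \<Longrightarrow>
               \<bar>f (x + 2 * s) - 2 * f (x + s) + f x\<bar> \<le> w"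
    and y: "y \<in> {0..1}"
  shows "\<bar>f y - lin_interp f y\<bar> \<le> w * (1 + y * (1 - y) / t\<^sup>2)"
proof (rule maximum_principle_second_difference[OF _ _ _ t w _ y])
  show "continuous_on {0..1} (\<lambda>y. f y - lin_interp f y)"
    unfolding lin_interp_def using cont by (intro continuous_intros)
  have *: "f (x + 2 * s) - lin_interp f (x + 2 * s) - 2 * (f (x + s) - lin_interp f (x + s))
      + (f x - lin_interp f x) = f (x + 2 * s) - 2 * f (x + s) + f x" for x s
    unfolding lin_interp_def by (simp add: algebra_simps)
  show "\<bar>f (x + 2 * s) - lin_interp f (x + 2 * s) - 2 * (f (x + s) - lin_interp f (x + s))
      + (f x - lin_interp f x)\<bar> \<le> w"
    if "0 < s" "s \<le> t" "0 \<le> x" "x + 2 * s \<le> 1" for s x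
    unfolding * using sd[OF that] .
qed (auto simp: lin_interp_def)

section \<open>Positive linear operators and their iterates\<close>

text \<open>
  Functions on \<open>[0,1]\<close> are represented by total functions, so linearity holds everywhere but order
  is compared on \<open>[0,1]\<close> only. This form of positivity is what iterates inherit.
\<close>

definition positive_linear :: "((real \<Rightarrow> real) \<Rightarrow> real \<Rightarrow> real) \<Rightarrow> bool" where
  "positive_linear T \<longleftrightarrow>
     (\<forall>a b f g. T (\<lambda>y. a * f y + b * g y) = (\<lambda>y. a * T f y + b * T g y)) \<and>
     (\<forall>f g. (\<forall>y\<in>{0..1}. f y \<le> g y) \<longrightarrow> (\<forall>y\<in>{0..1}. T f y \<le> T g y))"

lemma positive_linear_comb:
  assumes "positive_linear T"
  shows "T (\<lambda>y. a * f y + b * g y) = (\<lambda>y. a * T f y + b * T g y)"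
  using conjunct1[OF assms[unfolded positive_linear_def], rule_format, of a f b g] .

lemma positive_linear_scale:
  assumes "positive_linear T"
  shows "T (\<lambda>y. a * f y) = (\<lambda>y. a * T f y)"
  using positive_linear_comb[OF assms, of a f 0 f] by simp

lemma positive_linear_mono:
  assumes "positive_linear T" and "\<And>y. y \<in> {0..1} \<Longrightarrow> f y \<le> g y" and "x \<in> {0..1}"
  shows "T f x \<le> T g x"
  using conjunct2[OF assms(1)[unfolded positive_linear_def], rule_format, of f g x] assms(2,3)
  by blast

lemma positive_linear_funpow:
  assumes T: "positive_linear T"
  shows "positive_linear (T ^^ m)"
proof (induction m)
  case 0
  then show ?case by (simp add: positive_linear_def)
next
  case (Suc m)
  show ?case
    unfolding positive_linear_def funpow.simps comp_apply
  proof (intro conjI allI impI ballI)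
    fix a b f g
    show "T ((T ^^ m) (\<lambda>y. a * f y + b * g y)) =
        (\<lambda>y. a * T ((T ^^ m) f) y + b * T ((T ^^ m) g) y)"
      unfolding positive_linear_comb[OF Suc, of a f b g] by (rule positive_linear_comb[OF T])
  next
    fix f g :: "real \<Rightarrow> real" and x :: real
    assume "\<forall>y\<in>{0..1}. f y \<le> g y" and "x \<in> {0..1}"
    then show "T ((T ^^ m) f) x \<le> T ((T ^^ m) g) x"
      by (intro positive_linear_mono[OF T] positive_linear_mono[OF Suc]) auto
  qed
qed

lemma eigenfunction_funpow:
  assumes "positive_linear T" and "T g = (\<lambda>x. c * g x)"
  shows "(T ^^ m) g = (\<lambda>x. c ^ m * g x)"
proof (induction m)
  case (Suc m)
  then show ?case
    using assms positive_linear_scale[OF assms(1), of "c ^ m" g] by (simp add: mult_ac)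
qed simp

lemma positive_linear_lin_interp:
  assumes T: "positive_linear T" and one: "T (\<lambda>_. 1) x = 1"
  shows "T (lin_interp f) x = f 0 + (f 1 - f 0) * T (\<lambda>y. y) x"
proof -
  have "lin_interp f = (\<lambda>y. f 0 * 1 + (f 1 - f 0) * y)"
    by (auto simp: lin_interp_def algebra_simps)
  then show ?thesis
    using positive_linear_comb[OF T, of "f 0" "\<lambda>_. 1" "f 1 - f 0" "\<lambda>y. y"] one by simp
qed

lemma positive_operator_lin_interp_error:
  fixes f :: "real \<Rightarrow> real"
  assumes T: "positive_linear T" and one: "T (\<lambda>_. 1) x = 1"
    and x: "x \<in> {0..1}" and mu: "T (\<lambda>y. y * (1 - y)) x \<le> \<mu>"
    and cont: "continuous_on {0..1} f"
    and t: "0 < t" "t \<le> 1/2" and w: "0 \<le> w"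
    and sd: "\<And>s x. \<lbrakk>0 < s; s \<le> t; 0 \<le> x; x + 2 * s \<le> 1\<rbrakk> \<Longrightarrow>
               \<bar>f (x + 2 * s) - 2 * f (x + s) + f x\<bar> \<le> w"
  shows "\<bar>T f x - T (lin_interp f) x\<bar> \<le> w * (1 + \<mu> / t\<^sup>2)"
proof -
  define B where "B y = w * 1 + w / t\<^sup>2 * (y * (1 - y))" for y
  have err: "\<bar>f y - lin_interp f y\<bar> \<le> B y" if "y \<in> {0..1}" for y
    using lin_interp_error[OF cont t w sd that] by (simp add: B_def algebra_simps)
  have "T B x = w + w / t\<^sup>2 * T (\<lambda>y. y * (1 - y)) x"
    unfolding B_def
    using positive_linear_comb[OF T, of w "\<lambda>_. 1" "w / t\<^sup>2" "\<lambda>y. y * (1 - y)"] one by simp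
  also have "\<dots> \<le> w + w / t\<^sup>2 * \<mu>"
    using w mu by (intro add_left_mono mult_left_mono) auto
  also have "\<dots> = w * (1 + \<mu> / t\<^sup>2)"
    by (simp add: algebra_simps)
  finally have TB: "T B x \<le> w * (1 + \<mu> / t\<^sup>2)" .
  have upper: "T f x \<le> T (\<lambda>y. 1 * lin_interp f y + 1 * B y) x"
    by (rule positive_linear_mono[OF T _ x]) (use err in force)
  have lower: "T (\<lambda>y. 1 * lin_interp f y + (- 1) * B y) x \<le> T f x"
    by (rule positive_linear_mono[OF T _ x]) (use err in force)
  show ?thesis
    using upper lower TB
      positive_linear_comb[OF T, of 1 "lin_interp f" 1 B]
      positive_linear_comb[OF T, of 1 "lin_interp f" "- 1" B] by (simp add: abs_le_iff)
qed

text \<open>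
  The choice \<open>t = min (1/2) (sqrt \<mu>)\<close> makes \<open>\<mu> / t\<^sup>2\<close> at most \<open>4\<close>, which is where the
  constant \<open>5\<close> comes from. For \<open>\<mu> = 0\<close> no such \<open>t\<close> exists and the right-hand side is \<open>0\<close>;
  then \<open>t\<close> tends to \<open>0\<close> and the second differences vanish in the limit, by uniform continuity.
\<close>

lemma positive_operator_omega2:
  fixes f :: "real \<Rightarrow> real"
  assumes T: "positive_linear T" and one: "T (\<lambda>_. 1) x = 1"
    and x: "x \<in> {0..1}" and mu: "T (\<lambda>y. y * (1 - y)) x \<le> \<mu>" and mu01: "0 \<le> \<mu>" "\<mu> \<le> 1"
    and cont: "continuous_on {0..1} f"
  shows "\<bar>T f x - T (lin_interp f) x\<bar> \<le> 5 * omega2 f (sqrt \<mu>)"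
proof (cases "\<mu> = 0")
  case False
  define t where "t = min (1/2) (sqrt \<mu>)"
  have t: "0 < t" "t \<le> 1/2" "t \<le> sqrt \<mu>" using False mu01 by (auto simp: t_def)
  have ratio: "\<mu> / t\<^sup>2 \<le> 4"
    using mu01 False by (cases "1/2 \<le> sqrt \<mu>") (auto simp: t_def min_def power_divide)
  have "\<bar>T f x - T (lin_interp f) x\<bar> \<le> omega2 f (sqrt \<mu>) * (1 + \<mu> / t\<^sup>2)"
  proof (rule positive_operator_lin_interp_error[OF T one x mu cont t(1,2) omega2_nonneg[OF cont]])
    show "\<bar>f (x + 2 * s) - 2 * f (x + s) + f x\<bar> \<le> omega2 f (sqrt \<mu>)"
      if "0 < s" "s \<le> t" "0 \<le> x" "x + 2 * s \<le> 1" for s x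
      using that t by (intro second_difference_le_omega2[OF cont]) auto
  qed
  also have "\<dots> \<le> omega2 f (sqrt \<mu>) * 5"
    using ratio by (intro mult_left_mono omega2_nonneg[OF cont]) auto
  finally show ?thesis by simp
next
  case True
  have unif: "uniformly_continuous_on {0..1} f"
    using cont by (intro compact_uniformly_continuous) auto
  have "\<bar>T f x - T (lin_interp f) x\<bar> \<le> 0 + e" if e: "0 < e" for e
  proof -
    have "\<exists>d>0. \<forall>u\<in>{0..1}. \<forall>v\<in>{0..1}. dist v u < d \<longrightarrow> dist (f v) (f u) < e / 2"
      using e by (intro unif[unfolded uniformly_continuous_on_def, rule_format]) simp
    then obtain d where d: "0 < d"
      and close: "\<And>u v. \<lbrakk>u \<in> {0..1}; v \<in> {0..1}; dist v u < d\<rbrakk> \<Longrightarrow> dist (f v) (f u) < e / 2"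
      by blast
    define t where "t = min (1/2) (d / 2)"
    have t: "0 < t" "t \<le> 1/2" "t < d" using d by (auto simp: t_def)
    have "\<bar>T f x - T (lin_interp f) x\<bar> \<le> e * (1 + \<mu> / t\<^sup>2)"
    proof (rule positive_operator_lin_interp_error[OF T one x mu cont t(1,2)])
      show "\<bar>f (x + 2 * s) - 2 * f (x + s) + f x\<bar> \<le> e"
        if "0 < s" "s \<le> t" "0 \<le> x" "x + 2 * s \<le> 1" for s x
      proof -
        have "dist (f (x + 2 * s)) (f (x + s)) < e / 2"
          using that t by (intro close) (auto simp: dist_real_def)
        moreover have "dist (f x) (f (x + s)) < e / 2"
          using that t by (intro close) (auto simp: dist_real_def)
        ultimately show ?thesis unfolding dist_real_def by linarith
      qed
    qed (use e in auto)
    then show ?thesis using True by simp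
  qed
  then have "\<bar>T f x - T (lin_interp f) x\<bar> \<le> 0"
    by (rule field_le_epsilon)
  then show ?thesis using omega2_nonneg[OF cont, of "sqrt \<mu>"] by linarith
qed

section \<open>Gaussian binomial coefficients\<close>

lemma qnum_of_nat:
  assumes "0 < q"
  shows "qnum q (real n) = (\<Sum>i<n. q ^ i)"
  using assms by (auto simp: qnum_def powr_realpow sum_gp_strict)

lemma qnum_0: "0 < q \<Longrightarrow> qnum q 0 = 0"
  by (simp add: qnum_def)

lemma qnum_Suc_0: "0 < q \<Longrightarrow> qnum q (real (Suc 0)) = 1"
  by (simp add: qnum_of_nat del: of_nat_Suc)

lemma qnum_Suc: "0 < q \<Longrightarrow> qnum q (real (Suc n)) = qnum q (real n) + q ^ n"
  by (simp add: qnum_of_nat del: of_nat_Suc)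

lemma qnum_Suc_left: "0 < q \<Longrightarrow> qnum q (real (Suc n)) = 1 + q * qnum q (real n)"
  by (simp add: qnum_of_nat sum.lessThan_Suc_shift sum_distrib_left del: of_nat_Suc sum.lessThan_Suc)

lemma qnum_add: "0 < q \<Longrightarrow> qnum q (real (m + n)) = qnum q (real m) + q ^ m * qnum q (real n)"
  by (induction n) (simp_all add: qnum_0 qnum_Suc power_add algebra_simps del: of_nat_Suc of_nat_add)

lemma qnum_nat_nonneg: "0 < q \<Longrightarrow> 0 \<le> qnum q (real n)"
  by (simp add: qnum_of_nat sum_nonneg)

lemma qnum_nat_mono: "\<lbrakk>0 < q; m \<le> n\<rbrakk> \<Longrightarrow> qnum q (real m) \<le> qnum q (real n)"
  by (auto simp: qnum_of_nat intro!: sum_mono2)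

lemma qnum_nat_ge_1: "\<lbrakk>0 < q; 1 \<le> n\<rbrakk> \<Longrightarrow> 1 \<le> qnum q (real n)"
  using qnum_nat_mono[of q "Suc 0" n] by (simp add: qnum_Suc_0[simplified])

lemma qnum_pos: "\<lbrakk>0 < q; q \<le> 1; 0 < r\<rbrakk> \<Longrightarrow> 0 < qnum q r"
  using powr_less_mono2[of r q 1] by (auto simp: qnum_def intro!: divide_pos_pos)

lemma qfact_Suc: "qfact q (Suc n) = qfact q n * qnum q (real (Suc n))"
  by (simp add: qfact_def)

lemma qfact_0: "qfact q 0 = 1"
  by (simp add: qfact_def)

lemma qfact_pos: "0 < q \<Longrightarrow> 0 < qfact q n"
  unfolding qfact_def by (intro prod_pos) (use qnum_nat_ge_1 in force)

lemma qbinom_pos: "0 < q \<Longrightarrow> 0 < qbinom q n k"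
  by (simp add: qbinom_def qfact_pos)

lemma qbinom_0: "0 < q \<Longrightarrow> qbinom q n 0 = 1"
  using qfact_pos[of q n] by (simp add: qbinom_def qfact_0)

lemma qbinom_self: "0 < q \<Longrightarrow> qbinom q n n = 1"
  using qfact_pos[of q n] by (simp add: qbinom_def qfact_0)

lemma qbinom_absorb:
  assumes "0 < q" "j \<le> n"
  shows "qnum q (real (Suc j)) * qbinom q (Suc n) (Suc j) = qnum q (real (Suc n)) * qbinom q n j"
proof -
  have "qfact q j \<noteq> 0" "qfact q (n - j) \<noteq> 0" "qnum q (real (Suc j)) \<noteq> 0"
    using qfact_pos[OF assms(1), of j] qfact_pos[OF assms(1), of "n - j"]
      qnum_nat_ge_1[OF assms(1), of "Suc j"] by auto
  then show ?thesis
    by (simp add: qbinom_def qfact_Suc del: of_nat_Suc)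
qed

lemma qbinom_pascal:
  assumes q: "0 < q" and j: "Suc j \<le> n"
  shows "qbinom q (Suc n) (Suc j) = q ^ (n - j) * qbinom q n j + qbinom q n (Suc j)"
proof -
  obtain k where n: "n = Suc j + k" using j le_Suc_ex by blast
  have nz: "qfact q j \<noteq> 0" "qfact q k \<noteq> 0"
      "qnum q (real (Suc j)) \<noteq> 0" "qnum q (real (Suc k)) \<noteq> 0"
    using qfact_pos[OF q, of j] qfact_pos[OF q, of k]
      qnum_nat_ge_1[OF q, of "Suc j"] qnum_nat_ge_1[OF q, of "Suc k"] by auto
  have split: "qnum q (real (Suc n)) = qnum q (real (Suc k)) + q ^ Suc k * qnum q (real (Suc j))"
    using qnum_add[OF q, of "Suc k" "Suc j"] by (simp add: n add_ac)
  have diffs: "Suc n - Suc j = Suc k" "n - j = Suc k" "n - Suc j = k" by (auto simp: n)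
  show ?thesis
    unfolding qbinom_def diffs qfact_Suc[of q n] qfact_Suc[of q j] qfact_Suc[of q k] split
    using nz by (simp add: field_simps del: of_nat_Suc)
qed

section \<open>Moments of the Stancu basis\<close>

text \<open>
  These are the numerators of the Stancu basis functions, with the constant \<open>1\<close> replaced by a
  parameter \<open>y\<close>. The extra parameter makes the family closed under the index shift of
  \<open>stancu_numerator_shift\<close>.
\<close>

definition stancu_numerator :: "real \<Rightarrow> nat \<Rightarrow> nat \<Rightarrow> real \<Rightarrow> real \<Rightarrow> real \<Rightarrow> real" where
  "stancu_numerator q n j \<alpha> y x =
     qbinom q n j * ((\<Prod>i<j. x + \<alpha> * qnum q (real i)) *
                     (\<Prod>s<n - j. y - q ^ s * x + \<alpha> * qnum q (real s)))"

text \<open>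
  Induction on \<open>n\<close>: the new factor splits as
  \<open>y + \<alpha> [n] = q ^ (n - j) * (x + \<alpha> [j]) + (y - q ^ (n - j) * x + \<alpha> [n - j])\<close>, where the first
  summand extends the first product and the second one extends the second product. The
  coefficients recombine by Pascal's rule.
\<close>

lemma stancu_vandermonde:
  assumes q: "0 < q"
  shows "(\<Sum>j\<le>n. stancu_numerator q n j \<alpha> y x) = (\<Prod>i<n. y + \<alpha> * qnum q (real i))"
proof (induction n)
  case 0
  then show ?case by (simp add: stancu_numerator_def qbinom_0[OF q])
next
  case (Suc n)
  define A where "A j = (\<Prod>i<j. x + \<alpha> * qnum q (real i))" for j
  define B where "B k = (\<Prod>s<k. y - q ^ s * x + \<alpha> * qnum q (real s))" for k
  have num: "stancu_numerator q n j \<alpha> y x = qbinom q n j * (A j * B (n - j))" for n j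
    unfolding stancu_numerator_def A_def B_def ..
  have split: "stancu_numerator q n j \<alpha> y x * (y + \<alpha> * qnum q (real n)) =
      q ^ (n - j) * qbinom q n j * (A (Suc j) * B (n - j)) +
      qbinom q n j * (A j * B (Suc n - j))" if "j \<le> n" for j
  proof -
    have "qnum q (real n) = qnum q (real (n - j)) + q ^ (n - j) * qnum q (real j)"
      using qnum_add[OF q, of "n - j" j] that by simp
    then show ?thesis
      using that unfolding num by (simp add: A_def B_def Suc_diff_le algebra_simps)
  qed
  have "(\<Prod>i<Suc n. y + \<alpha> * qnum q (real i)) =
      (\<Sum>j\<le>n. stancu_numerator q n j \<alpha> y x * (y + \<alpha> * qnum q (real n)))"
    by (simp add: Suc[symmetric] sum_distrib_right)
  also have "\<dots> = (\<Sum>j\<le>n. q ^ (n - j) * qbinom q n j * (A (Suc j) * B (n - j))) +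
      (\<Sum>j\<le>n. qbinom q n j * (A j * B (Suc n - j)))"
    unfolding sum.distrib[symmetric] by (intro sum.cong) (auto simp: split)
  also have "(\<Sum>j\<le>n. qbinom q n j * (A j * B (Suc n - j))) =
      B (Suc n) + (\<Sum>j<n. qbinom q n (Suc j) * (A (Suc j) * B (n - j)))"
    unfolding sum.atMost_shift by (simp add: qbinom_0[OF q] A_def)
  also have "(\<Sum>j\<le>n. q ^ (n - j) * qbinom q n j * (A (Suc j) * B (n - j))) =
      (\<Sum>j<n. q ^ (n - j) * qbinom q n j * (A (Suc j) * B (n - j))) + A (Suc n)"
    unfolding lessThan_Suc_atMost[symmetric] sum.lessThan_Suc
    by (simp add: qbinom_self[OF q] B_def)
  also have "(\<Sum>j<n. q ^ (n - j) * qbinom q n j * (A (Suc j) * B (n - j))) + A (Suc n) +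
      (B (Suc n) + (\<Sum>j<n. qbinom q n (Suc j) * (A (Suc j) * B (n - j)))) =
      B (Suc n) + ((\<Sum>j<n. qbinom q (Suc n) (Suc j) * (A (Suc j) * B (n - j))) + A (Suc n))"
  proof -
    have "(\<Sum>j<n. qbinom q (Suc n) (Suc j) * (A (Suc j) * B (n - j))) =
        (\<Sum>j<n. q ^ (n - j) * qbinom q n j * (A (Suc j) * B (n - j))) +
        (\<Sum>j<n. qbinom q n (Suc j) * (A (Suc j) * B (n - j)))"
      unfolding sum.distrib[symmetric]
      by (intro sum.cong) (auto simp: qbinom_pascal[OF q] algebra_simps)
    then show ?thesis by simp
  qed
  also have "(\<Sum>j<n. qbinom q (Suc n) (Suc j) * (A (Suc j) * B (n - j))) + A (Suc n) =
      (\<Sum>j<Suc n. qbinom q (Suc n) (Suc j) * (A (Suc j) * B (n - j)))"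
    by (simp add: qbinom_self[OF q] B_def)
  also have "B (Suc n) + \<dots> = (\<Sum>j\<le>Suc n. stancu_numerator q (Suc n) j \<alpha> y x)"
    unfolding num sum.atMost_shift by (simp add: qbinom_0[OF q] A_def)
  finally show ?case by simp
qed

text \<open>
  Since \<open>[i + 1] = 1 + q [i]\<close>, the factors \<open>x + \<alpha> [i + 1]\<close> are again of the form
  \<open>x' + \<alpha>' [i]\<close> with \<open>x' = x + \<alpha>\<close> and \<open>\<alpha>' = q * \<alpha>\<close>. The second product is unchanged when
  \<open>y' = y + \<alpha>\<close>. Absorption of \<open>[j]\<close> into the binomial coefficient does the rest.
\<close>

lemma stancu_numerator_shift:
  assumes q: "0 < q" and j: "j \<le> n"
  shows "qnum q (real (Suc j)) * stancu_numerator q (Suc n) (Suc j) \<alpha> y x =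
    qnum q (real (Suc n)) * x * stancu_numerator q n j (q * \<alpha>) (y + \<alpha>) (x + \<alpha>)"
proof -
  have A: "(\<Prod>i<Suc j. x + \<alpha> * qnum q (real i)) =
      x * (\<Prod>i<j. (x + \<alpha>) + q * \<alpha> * qnum q (real i))"
    unfolding prod.lessThan_Suc_shift
    by (simp add: qnum_0[OF q] qnum_Suc_left[OF q] algebra_simps del: of_nat_Suc)
  have B: "y - q ^ s * x + \<alpha> * qnum q (real s) =
      (y + \<alpha>) - q ^ s * (x + \<alpha>) + q * \<alpha> * qnum q (real s)" for s
  proof -
    have "qnum q (real s) + q ^ s = 1 + q * qnum q (real s)"
      using qnum_Suc[OF q, of s] qnum_Suc_left[OF q, of s] by simp
    then have "\<alpha> * (qnum q (real s) + q ^ s) = \<alpha> * (1 + q * qnum q (real s))" by simp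
    then show ?thesis by (simp add: algebra_simps)
  qed
  let ?A = "\<Prod>i<j. (x + \<alpha>) + q * \<alpha> * qnum q (real i)"
  let ?B = "\<Prod>s<n - j. (y + \<alpha>) - q ^ s * (x + \<alpha>) + q * \<alpha> * qnum q (real s)"
  have "qnum q (real (Suc j)) * stancu_numerator q (Suc n) (Suc j) \<alpha> y x =
      (qnum q (real (Suc j)) * qbinom q (Suc n) (Suc j)) * x * (?A * ?B)"
    unfolding stancu_numerator_def A diff_Suc_Suc B by (simp only: mult_ac)
  also have "\<dots> = qnum q (real (Suc n)) * x *
      stancu_numerator q n j (q * \<alpha>) (y + \<alpha>) (x + \<alpha>)"
    unfolding qbinom_absorb[OF q j] stancu_numerator_def by (simp only: mult_ac)
  finally show ?thesis .
qed

lemma stancu_sum_absorb: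
  assumes q: "0 < q"
  shows "(\<Sum>j\<le>Suc n. qnum q (real j) * g j * stancu_numerator q (Suc n) j \<alpha> y x) =
    qnum q (real (Suc n)) * x *
      (\<Sum>j\<le>n. g (Suc j) * stancu_numerator q n j (q * \<alpha>) (y + \<alpha>) (x + \<alpha>))"
proof -
  have "(\<Sum>j\<le>Suc n. qnum q (real j) * g j * stancu_numerator q (Suc n) j \<alpha> y x) =
      (\<Sum>j\<le>n. qnum q (real (Suc j)) * g (Suc j) * stancu_numerator q (Suc n) (Suc j) \<alpha> y x)"
    unfolding sum.atMost_Suc_shift by (simp add: qnum_0[OF q])
  also have "\<dots> = (\<Sum>j\<le>n. qnum q (real (Suc n)) * x *
      (g (Suc j) * stancu_numerator q n j (q * \<alpha>) (y + \<alpha>) (x + \<alpha>)))"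
  proof (rule sum.cong[OF refl])
    fix j assume "j \<in> {..n}"
    then show "qnum q (real (Suc j)) * g (Suc j) * stancu_numerator q (Suc n) (Suc j) \<alpha> y x =
      qnum q (real (Suc n)) * x *
      (g (Suc j) * stancu_numerator q n j (q * \<alpha>) (y + \<alpha>) (x + \<alpha>))"
      using arg_cong[OF stancu_numerator_shift[OF q, of j n \<alpha> y x], of "\<lambda>u. g (Suc j) * u"]
      by (simp add: mult_ac del: of_nat_Suc)
  qed
  finally show ?thesis by (simp add: sum_distrib_left)
qed

text \<open>
  The shift turns the product over \<open>i < n\<close> into the product over \<open>1 \<le> i < n\<close>, which lacks the
  factor \<open>y\<close>; the identity is stated with this factor restored on the left, so that it holds for
  \<open>n = 0\<close> as well.
\<close>

lemma stancu_first_moment: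
  assumes q: "0 < q"
  shows "y * (\<Sum>j\<le>n. qnum q (real j) * stancu_numerator q n j \<alpha> y x) =
    qnum q (real n) * x * (\<Prod>i<n. y + \<alpha> * qnum q (real i))"
proof (cases n)
  case 0
  then show ?thesis by (simp add: qnum_0[OF q])
next
  case (Suc k)
  have "(\<Sum>j\<le>Suc k. qnum q (real j) * stancu_numerator q (Suc k) j \<alpha> y x) =
      qnum q (real (Suc k)) * x * (\<Prod>i<k. (y + \<alpha>) + q * \<alpha> * qnum q (real i))"
    using stancu_sum_absorb[OF q, where g = "\<lambda>_. 1" and n = k]
    by (simp add: stancu_vandermonde[OF q])
  moreover have "(\<Prod>i<Suc k. y + \<alpha> * qnum q (real i)) =
      y * (\<Prod>i<k. (y + \<alpha>) + q * \<alpha> * qnum q (real i))"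
    unfolding prod.lessThan_Suc_shift
    by (simp add: qnum_0[OF q] qnum_Suc_left[OF q] algebra_simps del: of_nat_Suc)
  ultimately show ?thesis using Suc by (simp add: mult_ac del: of_nat_Suc)
qed

text \<open>
  After absorbing one factor \<open>[j]\<close>, the remaining one is \<open>[j + 1] = 1 + q [j]\<close>, so the shifted
  family contributes its zeroth and first moments.
\<close>

lemma stancu_second_moment:
  assumes q: "0 < q"
  shows "y * (y + \<alpha>) * (\<Sum>j\<le>n. (qnum q (real j))\<^sup>2 * stancu_numerator q n j \<alpha> y x) =
    qnum q (real n) * x * ((y + \<alpha>) + (qnum q (real n) - 1) * (x + \<alpha>)) *
      (\<Prod>i<n. y + \<alpha> * qnum q (real i))"
proof (cases n)
  case 0
  then show ?thesis by (simp add: qnum_0[OF q])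
next
  case (Suc k)
  define N where "N j = stancu_numerator q k j (q * \<alpha>) (y + \<alpha>) (x + \<alpha>)" for j
  define R where "R = (\<Prod>i<k. (y + \<alpha>) + q * \<alpha> * qnum q (real i))"
  have zeroth: "(\<Sum>j\<le>k. N j) = R"
    unfolding N_def R_def by (rule stancu_vandermonde[OF q])
  have first: "(y + \<alpha>) * (\<Sum>j\<le>k. qnum q (real j) * N j) = qnum q (real k) * (x + \<alpha>) * R"
    unfolding N_def R_def by (rule stancu_first_moment[OF q])
  have "(\<Sum>j\<le>Suc k. (qnum q (real j))\<^sup>2 * stancu_numerator q (Suc k) j \<alpha> y x) =
      qnum q (real (Suc k)) * x * (\<Sum>j\<le>k. qnum q (real (Suc j)) * N j)"
    using stancu_sum_absorb[OF q, where g = "\<lambda>j. qnum q (real j)" and n = k]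
    unfolding N_def power2_eq_square .
  also have "(\<Sum>j\<le>k. qnum q (real (Suc j)) * N j) = R + q * (\<Sum>j\<le>k. qnum q (real j) * N j)"
    unfolding qnum_Suc_left[OF q] zeroth[symmetric]
    by (simp add: algebra_simps sum.distrib sum_distrib_left)
  finally have sum: "(\<Sum>j\<le>Suc k. (qnum q (real j))\<^sup>2 * stancu_numerator q (Suc k) j \<alpha> y x) =
      qnum q (real (Suc k)) * x * (R + q * (\<Sum>j\<le>k. qnum q (real j) * N j))" .
  have prod: "(\<Prod>i<Suc k. y + \<alpha> * qnum q (real i)) = y * R"
    unfolding prod.lessThan_Suc_shift R_def
    by (simp add: qnum_0[OF q] qnum_Suc_left[OF q] algebra_simps del: of_nat_Suc)
  have pred: "qnum q (real (Suc k)) - 1 = q * qnum q (real k)"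
    by (simp add: qnum_Suc_left[OF q] del: of_nat_Suc)
  define W where "W = R + q * (\<Sum>j\<le>k. qnum q (real j) * N j)"
  have W: "(y + \<alpha>) * W = ((y + \<alpha>) + q * qnum q (real k) * (x + \<alpha>)) * R"
    using arg_cong[OF first, of "\<lambda>u. q * u"] by (simp add: W_def algebra_simps)
  have "y * (y + \<alpha>) * (qnum q (real (Suc k)) * x * W) =
      y * qnum q (real (Suc k)) * x * ((y + \<alpha>) * W)"
    by (simp only: mult_ac)
  also have "\<dots> = qnum q (real (Suc k)) * x *
      ((y + \<alpha>) + q * qnum q (real k) * (x + \<alpha>)) * (y * R)"
    unfolding W by (simp only: mult_ac)
  finally show ?thesis
    unfolding Suc sum prod pred W_def .
qed

section \<open>The Stancu operators\<close>

lemma stancu_basis_conv_numerator: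
  "stancu_basis n j q \<alpha> x =
    stancu_numerator q n j \<alpha> 1 x / (\<Prod>i<n. 1 + \<alpha> * qnum q (real i))"
  by (simp add: stancu_basis_def stancu_numerator_def)

lemma stancu_denominator_pos:
  "\<lbrakk>0 < q; 0 \<le> \<alpha>\<rbrakk> \<Longrightarrow> 0 < (\<Prod>i<n. 1 + \<alpha> * qnum q (real i))"
  by (intro prod_pos) (simp add: add_pos_nonneg qnum_nat_nonneg)

lemma stancu_basis_nonneg:
  assumes q: "0 < q" "q \<le> 1" and a: "0 \<le> \<alpha>" and x: "x \<in> {0..1}"
  shows "0 \<le> stancu_basis n j q \<alpha> x"
proof -
  have "q ^ s * x \<le> 1" for s
    using q x by (intro mult_le_one power_le_one) auto
  then have "0 \<le> 1 - q ^ s * x + \<alpha> * qnum q (real s)" for s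
    using a qnum_nat_nonneg[OF q(1), of s] by simp
  then have "0 \<le> stancu_numerator q n j \<alpha> 1 x"
    unfolding stancu_numerator_def using q a x qnum_nat_nonneg[OF q(1)]
    by (intro mult_nonneg_nonneg prod_nonneg less_imp_le[OF qbinom_pos]) auto
  then show ?thesis
    unfolding stancu_basis_conv_numerator
    using stancu_denominator_pos[OF q(1) a] by (simp add: less_imp_le)
qed

lemma
  assumes q: "0 < q" and a: "0 \<le> \<alpha>"
  shows stancu_basis_sum: "(\<Sum>j\<le>n. stancu_basis n j q \<alpha> x) = 1"
    and stancu_basis_first_moment:
      "(\<Sum>j\<le>n. qnum q (real j) * stancu_basis n j q \<alpha> x) = qnum q (real n) * x"
    and stancu_basis_second_moment:
      "(\<Sum>j\<le>n. (qnum q (real j))\<^sup>2 * stancu_basis n j q \<alpha> x) =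
        qnum q (real n) * x * (1 + (qnum q (real n) - 1) * (x + \<alpha>) / (1 + \<alpha>))"
proof -
  define D where "D = (\<Prod>i<n. 1 + \<alpha> * qnum q (real i))"
  have D: "D \<noteq> 0" using stancu_denominator_pos[OF q a, of n] unfolding D_def by linarith
  have basis: "stancu_basis n j q \<alpha> x = stancu_numerator q n j \<alpha> 1 x / D" for j
    by (simp add: stancu_basis_conv_numerator D_def)
  show "(\<Sum>j\<le>n. stancu_basis n j q \<alpha> x) = 1"
    using stancu_vandermonde[OF q, of n \<alpha> 1 x] D
    by (simp add: basis D_def sum_divide_distrib[symmetric])
  show "(\<Sum>j\<le>n. qnum q (real j) * stancu_basis n j q \<alpha> x) = qnum q (real n) * x"
    using stancu_first_moment[OF q, of 1 n \<alpha> x] D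
    by (simp add: basis D_def[symmetric] sum_divide_distrib[symmetric])
  have "(1 + \<alpha>) * (\<Sum>j\<le>n. (qnum q (real j))\<^sup>2 * stancu_numerator q n j \<alpha> 1 x) =
    qnum q (real n) * x * ((1 + \<alpha>) + (qnum q (real n) - 1) * (x + \<alpha>)) * D"
    using stancu_second_moment[OF q, of 1 \<alpha> n x] by (simp add: D_def)
  then have "(\<Sum>j\<le>n. (qnum q (real j))\<^sup>2 * stancu_numerator q n j \<alpha> 1 x) / D =
    qnum q (real n) * x * ((1 + \<alpha>) + (qnum q (real n) - 1) * (x + \<alpha>)) / (1 + \<alpha>)"
    using D a by (simp add: field_simps)
  also have "\<dots> = qnum q (real n) * x * (1 + (qnum q (real n) - 1) * (x + \<alpha>) / (1 + \<alpha>))"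
  proof -
    have "1 + \<alpha> \<noteq> 0" using a by linarith
    then show ?thesis by (simp add: field_simps)
  qed
  finally show "(\<Sum>j\<le>n. (qnum q (real j))\<^sup>2 * stancu_basis n j q \<alpha> x) =
        qnum q (real n) * x * (1 + (qnum q (real n) - 1) * (x + \<alpha>) / (1 + \<alpha>))"
    by (simp add: basis sum_divide_distrib[symmetric])
qed

lemma positive_linear_q_stancu:
  assumes q: "0 < q" "q \<le> 1" and n: "1 \<le> n" and a: "0 \<le> \<alpha>" and g: "0 \<le> qnum q \<gamma>"
  shows "positive_linear (q_stancu n q \<alpha> 0 \<gamma>)"
  unfolding positive_linear_def
proof (intro conjI allI impI ballI)
  fix a b f g
  show "q_stancu n q \<alpha> 0 \<gamma> (\<lambda>y. a * f y + b * g y) =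
      (\<lambda>y. a * q_stancu n q \<alpha> 0 \<gamma> f y + b * q_stancu n q \<alpha> 0 \<gamma> g y)"
    by (rule ext) (simp add: q_stancu_def algebra_simps sum.distrib sum_distrib_left)
next
  fix f h :: "real \<Rightarrow> real" and x :: real
  assume le: "\<forall>y\<in>{0..1}. f y \<le> h y" and x: "x \<in> {0..1}"
  show "q_stancu n q \<alpha> 0 \<gamma> f x \<le> q_stancu n q \<alpha> 0 \<gamma> h x"
    unfolding q_stancu_def
  proof (intro sum_mono mult_right_mono stancu_basis_nonneg[OF q a x])
    fix j assume "j \<in> {0..n}"
    then have "qnum q (real j) \<le> qnum q (real n) + qnum q \<gamma>" "0 < qnum q (real n) + qnum q \<gamma>"
      using qnum_nat_mono[OF q(1), of j n] qnum_nat_ge_1[OF q(1) n] g by auto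
    then show "f ((qnum q (real j) + qnum q 0) / (qnum q (real n) + qnum q \<gamma>))
        \<le> h ((qnum q (real j) + qnum q 0) / (qnum q (real n) + qnum q \<gamma>))"
      using qnum_nat_nonneg[OF q(1), of j] by (intro le[rule_format]) (auto simp: qnum_0[OF q(1)])
  qed
qed

lemma q_stancu_const:
  assumes "0 < q" "0 \<le> \<alpha>"
  shows "q_stancu n q \<alpha> \<beta> \<gamma> (\<lambda>_. 1) = (\<lambda>_. 1)"
  by (rule ext) (simp add: q_stancu_def atLeast0AtMost stancu_basis_sum[OF assms])

lemma q_stancu_id:
  assumes q: "0 < q" and a: "0 \<le> \<alpha>"
  shows "q_stancu n q \<alpha> 0 \<gamma> (\<lambda>y. y) =
    (\<lambda>x. qnum q (real n) / (qnum q (real n) + qnum q \<gamma>) * x)"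
  by (rule ext) (simp add: q_stancu_def atLeast0AtMost qnum_0[OF q]
      sum_divide_distrib[symmetric] stancu_basis_first_moment[OF assms])

lemma q_stancu_quadratic:
  assumes q: "0 < q" and a: "0 \<le> \<alpha>" and n: "1 \<le> n"
  shows "q_stancu n q \<alpha> 0 0 (\<lambda>y. y * (1 - y)) =
    (\<lambda>x. (1 - 1 / qnum q (real n)) * (1 / (1 + \<alpha>)) * (x * (1 - x)))"
proof
  fix x
  define N where "N = qnum q (real n)"
  have N: "N \<noteq> 0" using qnum_nat_ge_1[OF q n] by (auto simp: N_def)
  have "q_stancu n q \<alpha> 0 0 (\<lambda>y. y * (1 - y)) x =
      (\<Sum>j\<le>n. qnum q (real j) * stancu_basis n j q \<alpha> x) / N -
      (\<Sum>j\<le>n. (qnum q (real j))\<^sup>2 * stancu_basis n j q \<alpha> x) / N\<^sup>2"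
    unfolding q_stancu_def atLeast0AtMost qnum_0[OF q] N_def[symmetric]
      sum_divide_distrib sum_subtractf[symmetric]
    by (intro sum.cong refl) (simp add: power2_eq_square right_diff_distrib left_diff_distrib)
  also have "\<dots> = x - x * (1 + (N - 1) * (x + \<alpha>) / (1 + \<alpha>)) / N"
    unfolding stancu_basis_first_moment[OF q a] stancu_basis_second_moment[OF q a]
      N_def[symmetric]
    using N by (simp add: power2_eq_square)
  also have "\<dots> = (1 - 1 / N) * (1 / (1 + \<alpha>)) * (x * (1 - x))"
  proof -
    have "1 + \<alpha> \<noteq> 0" using a by linarith
    then show ?thesis using N by (simp add: divide_simps) (simp add: algebra_simps)
  qed
  finally show "q_stancu n q \<alpha> 0 0 (\<lambda>y. y * (1 - y)) x =
      (1 - 1 / qnum q (real n)) * (1 / (1 + \<alpha>)) * (x * (1 - x))"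
    by (simp add: N_def)
qed

section \<open>Iterates\<close>

lemma stancu_iterates_lin_interp:
  assumes q: "0 < q" "q \<le> 1" and n: "1 \<le> n" and a: "0 \<le> \<alpha>"
    and x: "x \<in> {0..1}" and f: "continuous_on {0..1} f"
  shows "\<bar>(q_stancu n q \<alpha> 0 0 ^^ m) f x - lin_interp f x\<bar>
    \<le> 5 * omega2 f (sqrt (((1 - 1 / qnum q (real n)) * (1 / (1 + \<alpha>))) ^ m * (x * (1 - x))))"
proof -
  let ?S = "q_stancu n q \<alpha> 0 0"
  define \<rho> where "\<rho> = (1 - 1 / qnum q (real n)) * (1 / (1 + \<alpha>))"
  have N: "1 \<le> qnum q (real n)" by (rule qnum_nat_ge_1[OF q(1) n])
  have S: "positive_linear ?S"
    using q n a by (intro positive_linear_q_stancu) (auto simp: qnum_0)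
  note T = positive_linear_funpow[OF S, of m]
  have one: "(?S ^^ m) (\<lambda>_. 1) x = 1"
    using eigenfunction_funpow[OF S, where g = "\<lambda>_. 1" and c = 1 and m = m]
      q_stancu_const[OF q(1) a] by simp
  have "?S (\<lambda>y. y) = (\<lambda>x. x)"
    using q_stancu_id[OF q(1) a, of n 0] N by (simp add: qnum_0[OF q(1)])
  then have id: "(?S ^^ m) (\<lambda>y. y) x = x"
    using eigenfunction_funpow[OF S, where g = "\<lambda>y. y" and c = 1 and m = m] by simp
  have quad: "(?S ^^ m) (\<lambda>y. y * (1 - y)) x = \<rho> ^ m * (x * (1 - x))"
    using eigenfunction_funpow[OF S, where g = "\<lambda>y. y * (1 - y)" and c = \<rho> and m = m]
      q_stancu_quadratic[OF q(1) a n] by (simp add: \<rho>_def)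
  have P: "(?S ^^ m) (lin_interp f) x = lin_interp f x"
    unfolding positive_linear_lin_interp[OF T one] id by (simp add: lin_interp_def algebra_simps)
  have "0 \<le> 1 - 1 / qnum q (real n)" "1 - 1 / qnum q (real n) \<le> 1"
      "0 \<le> 1 / (1 + \<alpha>)" "1 / (1 + \<alpha>) \<le> 1"
    using N a by auto
  then have "0 \<le> \<rho>" "\<rho> \<le> 1"
    unfolding \<rho>_def by (blast intro: mult_nonneg_nonneg mult_le_one)+
  moreover have "0 \<le> x * (1 - x)" "x * (1 - x) \<le> 1"
    using x by (auto intro!: mult_le_one)
  ultimately have "0 \<le> \<rho> ^ m * (x * (1 - x))" "\<rho> ^ m * (x * (1 - x)) \<le> 1"
    by (auto intro!: mult_le_one power_le_one)
  from positive_operator_omega2[OF T one x eq_refl[OF quad] this f]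
  show ?thesis unfolding P \<rho>_def .
qed

text \<open>
  Here \<open>e\<^sub>2 \<le> e\<^sub>1\<close> on \<open>[0,1]\<close> gives \<open>\<lambda> = \<delta>\<close>, and both are an upper bound for the iterate at
  \<open>e\<^sub>1 - e\<^sub>2\<close>.
\<close>

lemma stancu_iterates_at_zero:
  assumes q: "0 < q" "q \<le> 1" and n: "1 \<le> n" and g: "0 < \<gamma>"
    and x: "x \<in> {0..1}" and f: "continuous_on {0..1} f"
  shows "\<bar>(q_stancu n q 0 0 \<gamma> ^^ m) f x - f 0\<bar>
    \<le> 5 * omega2 f (sqrt (stancu_lambda n q \<gamma> m x)) + 5 * sup_norm f * stancu_delta n q \<gamma> m x"
proof -
  let ?S = "q_stancu n q 0 0 \<gamma>"
  define c where "c = qnum q (real n) / (qnum q (real n) + qnum q \<gamma>)"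
  define \<delta> where "\<delta> = c ^ m * x"
  have N: "1 \<le> qnum q (real n)" by (rule qnum_nat_ge_1[OF q(1) n])
  have G: "0 < qnum q \<gamma>" by (rule qnum_pos[OF q g])
  have c: "0 \<le> c" "c \<le> 1" using N G by (auto simp: c_def)
  have \<delta>01: "0 \<le> \<delta>" "\<delta> \<le> 1"
    unfolding \<delta>_def using c x by (auto intro!: mult_le_one power_le_one)
  have S: "positive_linear ?S"
    using q n G by (intro positive_linear_q_stancu) auto
  note T = positive_linear_funpow[OF S, of m]
  have one: "(?S ^^ m) (\<lambda>_. 1) x = 1"
    using eigenfunction_funpow[OF S, where g = "\<lambda>_. 1" and c = 1 and m = m]
      q_stancu_const[OF q(1) order_refl] by simp
  have id: "(?S ^^ m) (\<lambda>y. y) x = \<delta>"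
    using eigenfunction_funpow[OF S, where g = "\<lambda>y. y" and c = c and m = m]
      q_stancu_id[OF q(1) order_refl] by (simp add: \<delta>_def c_def)
  have mono1: "mono_fun 1 = (\<lambda>y. y)" by (auto simp: mono_fun_def)
  have delta: "stancu_delta n q \<gamma> m x = \<delta>"
    unfolding stancu_delta_def mono1 by (rule id)
  have "(?S ^^ m) (mono_fun 2) x \<le> (?S ^^ m) (\<lambda>y. y) x"
    by (rule positive_linear_mono[OF T _ x])
       (auto simp: mono_fun_def power2_eq_square mult_left_le)
  then have lambda: "stancu_lambda n q \<gamma> m x = \<delta>"
    unfolding stancu_lambda_def mono1 id by simp
  have "(?S ^^ m) (\<lambda>y. y * (1 - y)) x \<le> (?S ^^ m) (\<lambda>y. y) x"
    by (rule positive_linear_mono[OF T _ x]) (auto simp: mult_left_le)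
  then have "\<bar>(?S ^^ m) f x - (?S ^^ m) (lin_interp f) x\<bar> \<le> 5 * omega2 f (sqrt \<delta>)"
    using positive_operator_omega2[OF T one x _ \<delta>01 f] id by simp
  moreover have "(?S ^^ m) (lin_interp f) x = f 0 + (f 1 - f 0) * \<delta>"
    using positive_linear_lin_interp[OF T one, of f] id by simp
  moreover have "\<bar>(f 1 - f 0) * \<delta>\<bar> \<le> 5 * sup_norm f * \<delta>"
  proof -
    obtain M where M: "\<forall>x\<in>{0..1}. \<bar>f x\<bar> \<le> M"
      using continuous_on_unit_bounded[OF f] by (elim exE)
    have "bdd_above ((\<lambda>x. \<bar>f x\<bar>) ` {0..1})"
      using M by (intro bdd_aboveI[where M = M]) auto
    then have "\<bar>f y\<bar> \<le> sup_norm f" if "y \<in> {0..1}" for y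
      unfolding sup_norm_def using that by (intro cSUP_upper)
    from this[of 0] this[of 1] have "\<bar>f 1 - f 0\<bar> \<le> 5 * sup_norm f" by simp
    then show ?thesis using \<delta>01 by (simp add: abs_mult mult_right_mono)
  qed
  ultimately show ?thesis unfolding delta lambda by linarith
qed

theorem theorem13:
  shows "\<exists>k::real. k > 0 \<and>
    (\<forall>(q::real) (n::nat) (m::nat). 0 < q \<and> q \<le> 1 \<and> n \<ge> 1 \<and> m \<ge> 1 \<longrightarrow>
      (\<forall>\<alpha>\<ge>0. \<forall>x\<in>{0..1}. \<forall>f::real \<Rightarrow> real. continuous_on {0..1} f \<longrightarrow>
        \<bar>(q_stancu n q \<alpha> 0 0 ^^ m) f x - lin_interp f x\<bar>
          \<le> k * omega2 f (sqrt (((1 - 1 / qnum q (real n)) * (1 / (1 + \<alpha>))) ^ m * (x * (1 - x))))) \<and>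
      (\<forall>\<gamma>>0. \<forall>x\<in>{0..1}. \<forall>f::real \<Rightarrow> real. continuous_on {0..1} f \<longrightarrow>
        \<bar>(q_stancu n q 0 0 \<gamma> ^^ m) f x - f 0\<bar>
          \<le> k * omega2 f (sqrt (stancu_lambda n q \<gamma> m x)) + k * sup_norm f * stancu_delta n q \<gamma> m x))"
  by (intro exI[of _ 5] conjI allI impI ballI)
     (simp, (elim conjE, rule stancu_iterates_lin_interp; assumption),
       (elim conjE, rule stancu_iterates_at_zero; assumption))

end
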